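(* (i) Let $\omega\in\mathcal{A}_1(\mathbb{Z})$. There is a constant $C>0$, depending only on $\|\omega\|_{\mathcal{A}_1(\mathbb{Z})}$, such that for every $x\in l^1_\omega$ and every $t>0$, $$\omega(\{k\in\mathbb{Z}:\mathcal{M}_\omega x(k)>t\})\le\frac{C}{t}\|x\|_{l^1_\omega}.$$ (ii) Let $1<p<\infty$ and $\omega\in\mathcal{A}_p(\mathbb{Z})$. There is a constant $C>0$, depending only on $p$ and $\|\omega\|_{\mathcal{A}_p(\mathbb{Z})}$, such that for every $x\in l^p_\omega$ we have $\mathcal{M}_\omega x\in l^p_\omega$ and $$\|\mathcal{M}_\omega x\|_{l^p_\omega}\le C\|x\|_{l^p_\omega}.$$
   Context: A discrete weight on $\mathbb{Z}$ is a sequence $\omega=\{\omega(k)\}_{k\in\mathbb{Z}}$ of positive real numbers; for $S\subset\mathbb{Z}$, $\omega(S):=\sum_{k\in S}\omega(k)$. Let $\mathbb{N}=\{0,1,2,\dots\}$ and, for $m\in\mathbb{Z}$, $N\in\mathbb{N}$, $S_{m,N}:=\{k\in\mathbb{Z}:|k-m|\le N\}$. An interval $J\subset\mathbb{Z}$ is a nonempty finite set of consecutive integers, and $|J|$ is its cardinality. $\omega\in\mathcal{A}_1(\mathbb{Z})$ means $\|\omega\|_{\mathcal{A}_1(\mathbb{Z})}:=\sup_{J}\frac1{|J|}\big(\frac{1}{\inf_{k\in J}\omega(k)}\sum_{k\in J}\omega(k)\big)<\infty$, and for $1<p<\infty$, $\omega\in\mathcal{A}_p(\mathbb{Z})$ means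 $$\|\omega\|_{\mathcal{A}_p(\mathbb{Z})}:=\sup_{J}\Big(\frac1{|J|}\sum_{k\in J}\omega(k)\Big)\Big(\frac1{|J|}\sum_{k\in J}\omega(k)^{-\frac1{p-1}}\Big)^{p-1}<\infty,$$ the suprema being over all intervals $J\subset\mathbb{Z}$. For $1\le p<\infty$, $l^p_\omega$ is the space of real sequences $x=\{x(k)\}_{k\in\mathbb{Z}}$ with $\|x\|_{l^p_\omega}:=\big(\sum_{k\in\mathbb{Z}}|x(k)|^p\omega(k)\big)^{1/p}<\infty$. The discrete weighted Hardy–Littlewood maximal operator is $$\mathcal{M}_\omega x(m):=\sup_{N\in\mathbb{N}}\frac1{\omega(S_{m,N})}\sum_{k\in S_{m,N}}|x(k)|\omega(k),\qquad m\in\mathbb{Z}.$$ *)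

theory Defs
  imports "HOL-Analysis.Analysis"
begin

definition discrete_weight :: "(int \<Rightarrow> real) \<Rightarrow> bool" where
  "discrete_weight \<omega> \<longleftrightarrow> (\<forall>k. 0 < \<omega> k)"

(* omega(S); extended-valued because S may be infinite *)
definition weight_of :: "(int \<Rightarrow> real) \<Rightarrow> int set \<Rightarrow> ennreal" where
  "weight_of \<omega> S = (\<Sum>\<^sub>\<infinity>k\<in>S. ennreal (\<omega> k))"

definition centered_interval :: "int \<Rightarrow> nat \<Rightarrow> int set" where
  "centered_interval m N = {k. \<bar>k - m\<bar> \<le> int N}"

definition int_intervals :: "int set set" where
  "int_intervals = {{a..b} | a b. a \<le> b}"

definition A1_norm :: "(int \<Rightarrow> real) \<Rightarrow> ennreal" where
  "A1_norm \<omega> = (SUP J\<in>int_intervals.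
     ennreal (1 / real (card J) * (1 / (INF k\<in>J. \<omega> k) * (\<Sum>k\<in>J. \<omega> k))))"

definition Ap_norm :: "real \<Rightarrow> (int \<Rightarrow> real) \<Rightarrow> ennreal" where
  "Ap_norm p \<omega> = (SUP J\<in>int_intervals.
     ennreal ((1 / real (card J) * (\<Sum>k\<in>J. \<omega> k)) *
       (1 / real (card J) * (\<Sum>k\<in>J. \<omega> k powr (- (1 / (p - 1))))) powr (p - 1)))"

definition A1_weights :: "(int \<Rightarrow> real) set" where
  "A1_weights = {\<omega>. discrete_weight \<omega> \<and> A1_norm \<omega> < \<infinity>}"

(* meant for 1 < p *)
definition Ap_weights :: "real \<Rightarrow> (int \<Rightarrow> real) set" where
  "Ap_weights p = {\<omega>. discrete_weight \<omega> \<and> Ap_norm p \<omega> < \<infinity>}"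

(* meant for 1 \<le> p *)
definition lp_space :: "real \<Rightarrow> (int \<Rightarrow> real) \<Rightarrow> (int \<Rightarrow> real) set" where
  "lp_space p \<omega> = {x. (\<lambda>k. \<bar>x k\<bar> powr p * \<omega> k) summable_on UNIV}"

(* infsum returns 0 on non-summable families, so this is the norm only on lp_space p \<omega> *)
definition lp_norm :: "real \<Rightarrow> (int \<Rightarrow> real) \<Rightarrow> (int \<Rightarrow> real) \<Rightarrow> real" where
  "lp_norm p \<omega> x = (\<Sum>\<^sub>\<infinity>k. \<bar>x k\<bar> powr p * \<omega> k) powr (1 / p)"

(* extended-valued: for an arbitrary sequence x the supremum may be infinite *)
definition maximal_op :: "(int \<Rightarrow> real) \<Rightarrow> (int \<Rightarrow> real) \<Rightarrow> int \<Rightarrow> ennreal" where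
  "maximal_op \<omega> x m = (SUP N. (\<Sum>k\<in>centered_interval m N. ennreal (\<bar>x k\<bar> * \<omega> k))
     / weight_of \<omega> (centered_interval m N))"

end

(* On the line, any finite family of intervals has a subfamily with the same union that covers no
   point more than twice. Hence the maximal operator of an arbitrary positive weight is of weak type
   (1,1) with constant 2, without any doubling or Muckenhoupt condition, and the bound on l^p follows
   by interpolation with the trivial bound at infinity. Fixing one nearly optimal radius per point
   reduces everything to finite sums. *)
theory Submission imports Defs begin

section \<open>Covering by intervals and the weak type inequality for finite sums\<close>

lemma interval_subcover:
  fixes a b :: "'i \<Rightarrow> 'a::linorder"
  assumes "finite I"
  obtains G where "G \<subseteq> I" "(\<Union>i\<in>G. {a i..b i}) = (\<Union>i\<in>I. {a i..b i})"
    "\<And>k. card {i\<in>G. k \<in> {a i..b i}} \<le> 2"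
proof -
  define P where "P G \<longleftrightarrow> G \<subseteq> I \<and> (\<Union>i\<in>G. {a i..b i}) = (\<Union>i\<in>I. {a i..b i})" for G
  have "P I" by (simp add: P_def)
  \<comment> \<open>In a minimal subcover, of three intervals with a common point, one lies in the union
    of the one reaching furthest left and the one reaching furthest right.\<close>
  then obtain G where G: "P G" and minimal: "\<And>H. P H \<Longrightarrow> card G \<le> card H"
    using ex_has_least_nat[of P I card] by blast
  have fin: "finite G" using G assms finite_subset by (auto simp: P_def)
  have "card {i\<in>G. k \<in> {a i..b i}} \<le> 2" for k
  proof (rule ccontr)
    define T where "T = {i\<in>G. k \<in> {a i..b i}}"
    assume "\<not> card {i\<in>G. k \<in> {a i..b i}} \<le> 2"
    then have three: "card T > 2" by (simp add: T_def)
    have finT: "finite T" using fin by (simp add: T_def)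
    have "T \<noteq> {}" using three by auto
    then have "Min (a ` T) \<in> a ` T" "Max (b ` T) \<in> b ` T" using finT by simp_all
    then obtain i j where "i \<in> T" "a i = Min (a ` T)" "j \<in> T" "b j = Max (b ` T)"
      by (metis imageE)
    then have i: "i \<in> T" "\<And>l. l \<in> T \<Longrightarrow> a i \<le> a l"
      and j: "j \<in> T" "\<And>l. l \<in> T \<Longrightarrow> b l \<le> b j"
      using finT by simp_all
    \<comment> \<open>The indices \<open>i\<close> and \<open>j\<close> may coincide; in either case
      more than two members of \<open>T\<close> leave a further index \<open>l\<close>.\<close>
    have "card {i, j} \<le> 2" by (simp add: card_insert_if)
    then have "\<not> T \<subseteq> {i, j}"
      using three card_mono[of "{i, j}" T] by auto
    then obtain l where l: "l \<in> T" "l \<noteq> i" "l \<noteq> j" by auto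
    \<comment> \<open>The common point \<open>k\<close> glues the two intervals together: what lies
      to its left is in the interval of \<open>i\<close>, what lies to its right in that of
      \<open>j\<close>.\<close>
    have "{a l..b l} \<subseteq> {a i..b i} \<union> {a j..b j}"
    proof
      fix z assume "z \<in> {a l..b l}"
      then have "a i \<le> z" "z \<le> b j" using i(2)[OF l(1)] j(2)[OF l(1)] by auto
      moreover have "k \<le> b i" "a j \<le> k" using i(1) j(1) by (auto simp: T_def)
      ultimately show "z \<in> {a i..b i} \<union> {a j..b j}" by auto
    qed
    moreover have "i \<in> G - {l}" "j \<in> G - {l}" "l \<in> G" using i j l by (auto simp: T_def)
    ultimately have "(\<Union>i\<in>G - {l}. {a i..b i}) = (\<Union>i\<in>G. {a i..b i})" by blast
    with G have "P (G - {l})" by (auto simp: P_def)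
    from minimal[OF this] show False
      using \<open>l \<in> G\<close> fin by (meson card_Diff1_less leD)
  qed
  with G that show ?thesis by (auto simp: P_def)
qed

text \<open>The averaging inequalities are added up over a subcover: on the left every point counts
  at least once, on the right at most twice, whence the factor 2. Here \<open>f\<close> already
  contains the weight, so that truncated densities can be inserted for it.\<close>

lemma weak_type_finite:
  fixes a b :: "int \<Rightarrow> int" and \<omega> f :: "int \<Rightarrow> real"
  assumes fin: "finite F" and mem: "\<And>m. m \<in> F \<Longrightarrow> m \<in> {a m..b m}"
    and \<omega>: "\<And>k. 0 \<le> \<omega> k" and f: "\<And>k. 0 \<le> f k" and t: "0 \<le> t"
    and avg: "\<And>m. m \<in> F \<Longrightarrow> t * (\<Sum>k\<in>{a m..b m}. \<omega> k) \<le> (\<Sum>k\<in>{a m..b m}. f k)"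
  shows "t * (\<Sum>k\<in>F. \<omega> k) \<le> 2 * (\<Sum>k\<in>(\<Union>m\<in>F. {a m..b m}). f k)"
proof -
  let ?J = "\<lambda>m. {a m..b m}"
  obtain G where G: "G \<subseteq> F" "(\<Union>m\<in>G. ?J m) = (\<Union>m\<in>F. ?J m)"
    and overlap: "\<And>k. card {m\<in>G. k \<in> ?J m} \<le> 2"
    using interval_subcover[OF fin, of a b] by blast
  have finG: "finite G" using G(1) fin by (rule finite_subset)
  let ?U = "\<Union>m\<in>G. ?J m"
  have finU: "finite ?U" using finG by auto
  \<comment> \<open>Double counting, applied below with \<open>h\<close> equal to \<omega> and to
    \<open>f\<close>.\<close>
  have count: "(\<Sum>m\<in>G. \<Sum>k\<in>?J m. h k) = (\<Sum>k\<in>?U. real (card {m\<in>G. k \<in> ?J m}) * h k)"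
    for h :: "int \<Rightarrow> real"
  proof -
    have "(\<Sum>k\<in>?J m. h k) = (\<Sum>k\<in>?U. if k \<in> ?J m then h k else 0)" if "m \<in> G" for m
      using that finU by (intro sum.mono_neutral_cong_left) auto
    then have "(\<Sum>m\<in>G. \<Sum>k\<in>?J m. h k) = (\<Sum>m\<in>G. \<Sum>k\<in>?U. if k \<in> ?J m then h k else 0)"
      by (rule sum.cong[OF refl])
    also have "\<dots> = (\<Sum>k\<in>?U. \<Sum>m\<in>G. if k \<in> ?J m then h k else 0)"
      by (rule sum.swap)
    also have "\<dots> = (\<Sum>k\<in>?U. real (card {m\<in>G. k \<in> ?J m}) * h k)"
      by (intro sum.cong refl) (simp only: sum.inter_filter[OF finG, symmetric] sum_constant)
    finally show ?thesis .
  qed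
  have covered: "1 \<le> card {m\<in>G. k \<in> ?J m}" if "k \<in> ?U" for k
    using that finG by (auto simp: Suc_le_eq card_gt_0_iff)
  have "(\<Sum>k\<in>F. \<omega> k) \<le> (\<Sum>k\<in>?U. \<omega> k)"
    using mem G(2) \<omega> by (intro sum_mono2 finU) auto
  also have "\<dots> \<le> (\<Sum>m\<in>G. \<Sum>k\<in>?J m. \<omega> k)"
    unfolding count using mult_right_mono[OF _ \<omega>, of 1] covered
    by (intro sum_mono) fastforce
  finally have "t * (\<Sum>k\<in>F. \<omega> k) \<le> t * (\<Sum>m\<in>G. \<Sum>k\<in>?J m. \<omega> k)"
    using t by (rule mult_left_mono)
  also have "\<dots> \<le> (\<Sum>m\<in>G. \<Sum>k\<in>?J m. f k)"
    unfolding sum_distrib_left[of t _ G] using avg G(1) by (intro sum_mono) auto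
  also have "\<dots> = (\<Sum>k\<in>?U. real (card {m\<in>G. k \<in> ?J m}) * f k)"
    by (rule count)
  also have "\<dots> \<le> (\<Sum>k\<in>?U. 2 * f k)"
    using overlap f by (intro sum_mono mult_right_mono) (metis of_nat_le_iff of_nat_numeral)
  finally show ?thesis using G(2) by (simp add: sum_distrib_left)
qed

section \<open>Interpolation on finite sums\<close>

text \<open>The layer cake formula for a power. The range \<open>-1 < s\<close> admits the exponent
  \<open>p - 2\<close>, which may be singular at 0, and the free bound \<open>R\<close> lets terms
  with different \<open>c\<close> be integrated over one interval.\<close>

lemma has_integral_powr_below:
  fixes s c R :: real
  assumes "-1 < s" "0 \<le> c" "c \<le> R"
  shows "((\<lambda>t. if t < c then t powr s else 0) has_integral c powr (s + 1) / (s + 1)) {0..R}"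
proof -
  have "((\<lambda>t. t powr s) has_integral c powr (s + 1) / (s + 1)) {0..c}"
    using assms by (intro has_integral_powr_from_0) auto
  then have "((\<lambda>t. if t \<in> {0..c} then t powr s else 0) has_integral c powr (s + 1) / (s + 1)) {0..R}"
    using assms by (subst has_integral_restrict) auto
  \<comment> \<open>On \<open>{0..R}\<close> the conditions \<open>t \<in> {0..c}\<close> and
    \<open>t < c\<close> differ only at \<open>c\<close>.\<close>
  then show ?thesis
    by (rule has_integral_spike_finite[of "{c}", rotated 2]) auto
qed

text \<open>Marcinkiewicz interpolation between the weak type bound and the trivial bound at infinity:
  at height \<open>t\<close> only the part of \<open>f\<close> exceeding \<open>t / 2\<close> matters, and the bounds are
  integrated against \<open>t powr (p - 1)\<close>.\<close>

lemma strong_type_finite: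
  fixes a b :: "int \<Rightarrow> int" and \<omega> f g :: "int \<Rightarrow> real"
  assumes p: "1 < p" and fin: "finite F" and mem: "\<And>m. m \<in> F \<Longrightarrow> m \<in> {a m..b m}"
    and \<omega>: "\<And>k. 0 \<le> \<omega> k" and f: "\<And>k. 0 \<le> f k" and g: "\<And>m. 0 \<le> g m"
    and avg: "\<And>m. m \<in> F \<Longrightarrow>
      g m * (\<Sum>k\<in>{a m..b m}. \<omega> k) \<le> (\<Sum>k\<in>{a m..b m}. f k * \<omega> k)"
  shows "(\<Sum>m\<in>F. g m powr p * \<omega> m)
    \<le> 2 powr (p + 1) * p / (p - 1) * (\<Sum>k\<in>(\<Union>m\<in>F. {a m..b m}). f k powr p * \<omega> k)"
proof -
  let ?J = "\<lambda>m. {a m..b m}"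
  let ?U = "\<Union>m\<in>F. ?J m"
  have finU: "finite ?U" using fin by auto
  \<comment> \<open>A height beyond which both integrands vanish; the inserted 0 keeps
    \<open>Max\<close> meaningful when \<open>F\<close> is empty.\<close>
  define R where "R = Max (insert 0 (g ` F \<union> (\<lambda>k. 2 * f k) ` ?U))"
  have gR: "g m \<le> R" if "m \<in> F" for m
    unfolding R_def using that fin finU by (intro Max_ge) auto
  have fR: "2 * f k \<le> R" if "k \<in> ?U" for k
    unfolding R_def using that fin finU by (intro Max_ge) (auto intro: imageI)
  have lhs: "((\<lambda>t. \<Sum>m\<in>F. \<omega> m * (if t < g m then t powr (p - 1) else 0)) has_integral
      (\<Sum>m\<in>F. \<omega> m * (g m powr (p - 1 + 1) / (p - 1 + 1)))) {0..R}"
    using p g gR fin by (intro has_integral_sum has_integral_mult_right has_integral_powr_below) auto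
  \<comment> \<open>The exponent is one lower than on the left because the weak type bound carries a
    factor \<open>1 / t\<close>. The 4 is the overlap 2 times the 2 from truncating at
    \<open>t / 2\<close>.\<close>
  have rhs: "((\<lambda>t. \<Sum>k\<in>?U. (4 * f k * \<omega> k) * (if t < 2 * f k then t powr (p - 2) else 0)) has_integral
      (\<Sum>k\<in>?U. (4 * f k * \<omega> k) * ((2 * f k) powr (p - 2 + 1) / (p - 2 + 1)))) {0..R}"
    using p f fR finU by (intro has_integral_sum has_integral_mult_right has_integral_powr_below) auto
  have level: "(\<Sum>m\<in>F. \<omega> m * (if t < g m then t powr (p - 1) else 0))
      \<le> (\<Sum>k\<in>?U. (4 * f k * \<omega> k) * (if t < 2 * f k then t powr (p - 2) else 0))"
    if "t \<in> {0..R}" for t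
  proof (cases "t = 0")
    \<comment> \<open>Both sides are 0, since \<open>0 powr s = 0\<close> for every
      \<open>s\<close>, including \<open>s = 0\<close>.\<close>
    case True
    then show ?thesis by (simp add: if_distrib cong: if_cong)
  next
    case False
    with that have t: "0 < t" by auto
    let ?E = "{m\<in>F. t < g m}"
    define h where "h k = (if t < 2 * f k then f k * \<omega> k else 0)" for k
    have h0: "0 \<le> h k" for k using f \<omega> by (simp add: h_def)
    \<comment> \<open>The discarded values of \<open>f\<close> are at most \<open>t / 2\<close>, so
      they account for at most half of an average exceeding \<open>t\<close>.\<close>
    have "t / 2 * sum \<omega> (?J m) \<le> sum h (?J m)" if "m \<in> ?E" for m
    proof -
      have "t * sum \<omega> (?J m) \<le> g m * sum \<omega> (?J m)"
        using that \<omega> by (intro mult_right_mono sum_nonneg) auto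
      also have "\<dots> \<le> (\<Sum>k\<in>?J m. f k * \<omega> k)" using avg that by auto
      also have "\<dots> \<le> (\<Sum>k\<in>?J m. h k + t / 2 * \<omega> k)"
      proof (intro sum_mono)
        fix k
        have "f k * \<omega> k \<le> t / 2 * \<omega> k" if "\<not> t < 2 * f k"
          using that \<omega> by (intro mult_right_mono) auto
        then show "f k * \<omega> k \<le> h k + t / 2 * \<omega> k"
          using \<omega>[of k] t by (auto simp: h_def)
      qed
      finally show ?thesis unfolding sum.distrib sum_distrib_left[symmetric] by simp
    qed
    then have "t / 2 * sum \<omega> ?E \<le> 2 * sum h (\<Union>m\<in>?E. ?J m)"
      using fin mem \<omega> h0 t by (intro weak_type_finite) auto
    also have "\<dots> \<le> 2 * sum h ?U"
      using h0 finU by (intro mult_left_mono sum_mono2) auto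
    finally have "t powr (p - 2) * (t * sum \<omega> ?E) \<le> t powr (p - 2) * (4 * sum h ?U)"
      by (intro mult_left_mono) auto
    moreover have "t powr (p - 2) * t = t powr (p - 1)"
      using t by (simp add: powr_mult_base mult.commute)
    moreover have "(\<Sum>m\<in>F. \<omega> m * (if t < g m then t powr (p - 1) else 0)) = t powr (p - 1) * sum \<omega> ?E"
      using fin by (simp add: sum_distrib_left sum.inter_filter mult.commute if_distrib cong: if_cong)
    moreover have "(\<Sum>k\<in>?U. (4 * f k * \<omega> k) * (if t < 2 * f k then t powr (p - 2) else 0))
        = t powr (p - 2) * (4 * sum h ?U)"
      unfolding sum_distrib_left by (intro sum.cong) (auto simp: h_def)
    ultimately show ?thesis by (simp add: mult.assoc[symmetric])
  qed
  have transform: "(4 * f k * \<omega> k) * ((2 * f k) powr (p - 1) / (p - 1))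
      = 2 powr (p + 1) / (p - 1) * (f k powr p * \<omega> k)" for k
  proof -
    have "(2::real) powr (p + 1) = 4 * 2 powr (p - 1)"
      using powr_add[of "2::real" 2 "p - 1"] by (simp add: add.commute)
    moreover have "f k powr p = f k * f k powr (p - 1)"
      using f[of k] by (simp add: powr_mult_base)
    ultimately show ?thesis using f[of k] by (simp add: powr_mult)
  qed
  have "(\<Sum>m\<in>F. \<omega> m * (g m powr p / p))
      \<le> (\<Sum>k\<in>?U. (4 * f k * \<omega> k) * ((2 * f k) powr (p - 1) / (p - 1)))"
    using has_integral_le[OF lhs rhs level] by simp
  moreover have "(\<Sum>m\<in>F. \<omega> m * (g m powr p / p)) = (\<Sum>m\<in>F. g m powr p * \<omega> m) / p"
    by (simp add: sum_divide_distrib mult.commute)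
  ultimately have "(\<Sum>m\<in>F. g m powr p * \<omega> m) / p
      \<le> 2 powr (p + 1) / (p - 1) * (\<Sum>k\<in>?U. f k powr p * \<omega> k)"
    by (simp only: transform sum_distrib_left)
  then show ?thesis using p by (simp add: field_simps)
qed

section \<open>From finite sums to the maximal operator\<close>

lemma centered_interval_eq: "centered_interval m N = {m - int N..m + int N}"
  by (auto simp: centered_interval_def)

text \<open>A value strictly below a supremum is exceeded by one of its members. This fixes the
  radius and turns the extended-valued quotient into the real inequality that the finite lemmas
  take.\<close>

lemma less_maximal_opD:
  assumes \<omega>: "discrete_weight \<omega>" and c: "0 \<le> c" and less: "ennreal c < maximal_op \<omega> x m"
  obtains N where "c * (\<Sum>k\<in>{m - int N..m + int N}. \<omega> k)
    \<le> (\<Sum>k\<in>{m - int N..m + int N}. \<bar>x k\<bar> * \<omega> k)"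
proof -
  obtain N where N: "ennreal c < (\<Sum>k\<in>centered_interval m N. ennreal (\<bar>x k\<bar> * \<omega> k))
      / weight_of \<omega> (centered_interval m N)"
    using less by (auto simp: maximal_op_def less_SUP_iff)
  let ?J = "{m - int N..m + int N}"
  have pos: "0 < \<omega> k" for k using \<omega> by (simp add: discrete_weight_def)
  have W: "0 < sum \<omega> ?J" using pos by (intro sum_pos) auto
  have "weight_of \<omega> ?J = ennreal (sum \<omega> ?J)"
    using pos by (simp add: weight_of_def less_imp_le)
  moreover have "(\<Sum>k\<in>?J. ennreal (\<bar>x k\<bar> * \<omega> k)) = ennreal (\<Sum>k\<in>?J. \<bar>x k\<bar> * \<omega> k)"
    using pos by (intro sum_ennreal) (simp add: less_imp_le)
  moreover have "0 \<le> (\<Sum>k\<in>?J. \<bar>x k\<bar> * \<omega> k)"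
    using pos by (intro sum_nonneg) (simp add: less_imp_le)
  ultimately have "ennreal c < ennreal ((\<Sum>k\<in>?J. \<bar>x k\<bar> * \<omega> k) / sum \<omega> ?J)"
    using N W by (simp add: centered_interval_eq divide_ennreal)
  then have "c < (\<Sum>k\<in>?J. \<bar>x k\<bar> * \<omega> k) / sum \<omega> ?J"
    using c by (simp add: ennreal_less_iff)
  then show ?thesis using W by (intro that[of N]) (simp add: field_simps)
qed

text \<open>The weight of the level set is the supremum over its finite subsets \<open>F\<close>.
  Each point of \<open>F\<close> is given one radius, and \<open>weak_type_finite\<close> bounds all
  these sums alike.\<close>

lemma weight_maximal_op_superlevel_le:
  assumes \<omega>: "discrete_weight \<omega>" and x: "x \<in> lp_space 1 \<omega>" and t: "0 < t"
  shows "weight_of \<omega> {k. maximal_op \<omega> x k > ennreal t} \<le> ennreal (2 / t * lp_norm 1 \<omega> x)"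
  unfolding weight_of_def
proof (rule infsum_le_finite_sums)
  show "(\<lambda>k. ennreal (\<omega> k)) summable_on {k. maximal_op \<omega> x k > ennreal t}"
    by (rule nonneg_summable_on_complete) simp
next
  fix F assume F: "finite F" "F \<subseteq> {k. maximal_op \<omega> x k > ennreal t}"
  have \<omega>0: "0 \<le> \<omega> k" for k using \<omega> by (simp add: discrete_weight_def less_imp_le)
  have "\<forall>m\<in>F. \<exists>N. t * (\<Sum>k\<in>{m - int N..m + int N}. \<omega> k)
      \<le> (\<Sum>k\<in>{m - int N..m + int N}. \<bar>x k\<bar> * \<omega> k)"
    using less_maximal_opD[OF \<omega>, of t x] F(2) t by (smt (verit) less_imp_le mem_Collect_eq subset_iff)
  then obtain N where N: "\<And>m. m \<in> F \<Longrightarrow> t * (\<Sum>k\<in>{m - int (N m)..m + int (N m)}. \<omega> k)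
      \<le> (\<Sum>k\<in>{m - int (N m)..m + int (N m)}. \<bar>x k\<bar> * \<omega> k)"
    by metis
  have "t * sum \<omega> F \<le> 2 * (\<Sum>k\<in>(\<Union>m\<in>F. {m - int (N m)..m + int (N m)}). \<bar>x k\<bar> * \<omega> k)"
    using N t \<omega>0 F(1) by (intro weak_type_finite) auto
  also have "\<dots> \<le> 2 * (\<Sum>\<^sub>\<infinity>k. \<bar>x k\<bar> * \<omega> k)"
    using x \<omega>0 F(1) by (intro mult_left_mono finite_sum_le_infsum) (auto simp: lp_space_def)
  also have "\<dots> = 2 * lp_norm 1 \<omega> x"
    using \<omega>0 by (simp add: lp_norm_def infsum_nonneg)
  finally have "sum \<omega> F \<le> 2 / t * lp_norm 1 \<omega> x"
    using t by (simp add: field_simps)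
  then show "(\<Sum>k\<in>F. ennreal (\<omega> k)) \<le> ennreal (2 / t * lp_norm 1 \<omega> x)"
    using \<omega>0 by (simp add: ennreal_leI)
qed

section \<open>Finiteness and the strong type inequality\<close>

text \<open>Working with real minorants \<open>c\<close> avoids presupposing that the maximal
  function is finite, so the same bound can first prove finiteness. The alternative
  \<open>c m = 0\<close> covers points where nothing lies strictly below the maximal
  function.\<close>

lemma sum_powr_le_of_less_maximal_op:
  assumes \<omega>: "discrete_weight \<omega>" and p: "1 < p" and x: "x \<in> lp_space p \<omega>" and F: "finite F"
    and c: "\<And>m. 0 \<le> c m" "\<And>m. m \<in> F \<Longrightarrow> c m = 0 \<or> ennreal (c m) < maximal_op \<omega> x m"
  shows "(\<Sum>m\<in>F. c m powr p * \<omega> m)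
    \<le> 2 powr (p + 1) * p / (p - 1) * (\<Sum>\<^sub>\<infinity>k. \<bar>x k\<bar> powr p * \<omega> k)"
proof -
  have \<omega>0: "0 \<le> \<omega> k" for k using \<omega> by (simp add: discrete_weight_def less_imp_le)
  have "\<exists>N. c m * (\<Sum>k\<in>{m - int N..m + int N}. \<omega> k)
      \<le> (\<Sum>k\<in>{m - int N..m + int N}. \<bar>x k\<bar> * \<omega> k)" if "m \<in> F" for m
  proof (cases "c m = 0")
    case True
    then show ?thesis using \<omega>0 by (auto intro!: sum_nonneg)
  next
    case False
    then show ?thesis using less_maximal_opD[OF \<omega> c(1)] c(2)[OF that] by blast
  qed
  then obtain N where N: "\<And>m. m \<in> F \<Longrightarrow> c m * (\<Sum>k\<in>{m - int (N m)..m + int (N m)}. \<omega> k)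
      \<le> (\<Sum>k\<in>{m - int (N m)..m + int (N m)}. \<bar>x k\<bar> * \<omega> k)"
    by metis
  have "(\<Sum>m\<in>F. c m powr p * \<omega> m) \<le> 2 powr (p + 1) * p / (p - 1) *
      (\<Sum>k\<in>(\<Union>m\<in>F. {m - int (N m)..m + int (N m)}). \<bar>x k\<bar> powr p * \<omega> k)"
    using N p \<omega>0 F c(1) by (intro strong_type_finite) auto
  also have "\<dots> \<le> 2 powr (p + 1) * p / (p - 1) * (\<Sum>\<^sub>\<infinity>k. \<bar>x k\<bar> powr p * \<omega> k)"
    using x \<omega>0 F p by (intro mult_left_mono finite_sum_le_infsum) (auto simp: lp_space_def)
  finally show ?thesis .
qed

text \<open>Below an infinite value every real constant is an admissible minorant, but on the single
  point \<open>m\<close> the minorants are bounded.\<close>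

lemma maximal_op_finite:
  assumes \<omega>: "discrete_weight \<omega>" and p: "1 < p" and x: "x \<in> lp_space p \<omega>"
  shows "maximal_op \<omega> x m < \<infinity>"
proof (rule ccontr)
  assume "\<not> maximal_op \<omega> x m < \<infinity>"
  then have top: "maximal_op \<omega> x m = \<infinity>" by (simp add: less_top[symmetric])
  define A where "A = 2 powr (p + 1) * p / (p - 1) * (\<Sum>\<^sub>\<infinity>k. \<bar>x k\<bar> powr p * \<omega> k)"
  have pos: "0 < \<omega> k" for k using \<omega> by (simp add: discrete_weight_def)
  have "0 \<le> A"
    unfolding A_def using p pos by (intro mult_nonneg_nonneg infsum_nonneg) (auto simp: less_imp_le)
  \<comment> \<open>Chosen so that \<open>c powr p * \<omega> m\<close> equals
    \<open>A + 1\<close>.\<close>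
  define c where "c = ((A + 1) / \<omega> m) powr (1 / p)"
  have "c powr p * \<omega> m \<le> A"
    using sum_powr_le_of_less_maximal_op[OF \<omega> p x, of "{m}" "\<lambda>_. c"] top
    by (simp add: A_def c_def)
  moreover have "c powr p = (A + 1) / \<omega> m"
    using p pos[of m] \<open>0 \<le> A\<close> by (simp add: c_def powr_powr)
  ultimately show False using pos[of m] by simp
qed

text \<open>One bound on all finite partial sums gives both summability and the norm estimate. As
  \<open>enn2real\<close> sends infinity to 0, the result describes the maximal function itself only
  together with \<open>maximal_op_finite\<close>.\<close>

lemma maximal_op_strong_type:
  fixes p :: real
  defines "K \<equiv> 2 powr p * (2 powr (p + 1) * p / (p - 1))"
  assumes \<omega>: "discrete_weight \<omega>" and p: "1 < p" and x: "x \<in> lp_space p \<omega>"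
  shows "(\<lambda>m. enn2real (maximal_op \<omega> x m)) \<in> lp_space p \<omega>"
    and "lp_norm p \<omega> (\<lambda>m. enn2real (maximal_op \<omega> x m)) \<le> K powr (1 / p) * lp_norm p \<omega> x"
proof -
  define g where "g m = enn2real (maximal_op \<omega> x m)" for m
  define X where "X = (\<Sum>\<^sub>\<infinity>k. \<bar>x k\<bar> powr p * \<omega> k)"
  have \<omega>0: "0 \<le> \<omega> k" for k using \<omega> by (simp add: discrete_weight_def less_imp_le)
  have g0: "0 \<le> g m" for m by (simp add: g_def)
  have X0: "0 \<le> X" unfolding X_def using \<omega>0 by (intro infsum_nonneg) auto
  have K0: "0 \<le> K" using p by (simp add: K_def)
  \<comment> \<open>Halving provides a value strictly below the supremum, at the cost of a factor
    \<open>2 powr p\<close>.\<close>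
  have half: "g m / 2 = 0 \<or> ennreal (g m / 2) < maximal_op \<omega> x m" for m
  proof (cases "g m = 0")
    case False
    then have "ennreal (g m / 2) < ennreal (g m)"
      using g0[of m] by (intro ennreal_lessI) auto
    then show ?thesis
      using maximal_op_finite[OF \<omega> p x, of m] by (simp add: g_def)
  qed simp
  have bound: "(\<Sum>m\<in>F. \<bar>g m\<bar> powr p * \<omega> m) \<le> K * X" if "finite F" for F
  proof -
    have "(\<Sum>m\<in>F. \<bar>g m\<bar> powr p * \<omega> m) = 2 powr p * (\<Sum>m\<in>F. (g m / 2) powr p * \<omega> m)"
      using g0 by (simp add: sum_distrib_left powr_divide)
    also have "\<dots> \<le> 2 powr p * (2 powr (p + 1) * p / (p - 1) * X)"
      unfolding X_def using sum_powr_le_of_less_maximal_op[OF \<omega> p x that, of "\<lambda>m. g m / 2"] g0 half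
      by (intro mult_left_mono) auto
    finally show ?thesis by (simp add: K_def)
  qed
  have summable: "(\<lambda>m. \<bar>g m\<bar> powr p * \<omega> m) summable_on UNIV"
    using \<omega>0 bound by (intro nonneg_bdd_above_summable_on bdd_aboveI2[where M = "K * X"]) auto
  then show "(\<lambda>m. enn2real (maximal_op \<omega> x m)) \<in> lp_space p \<omega>"
    by (simp add: lp_space_def g_def)
  have "(\<Sum>\<^sub>\<infinity>m. \<bar>g m\<bar> powr p * \<omega> m) \<le> K * X"
    using summable bound by (intro infsum_le_finite_sums) auto
  then have "(\<Sum>\<^sub>\<infinity>m. \<bar>g m\<bar> powr p * \<omega> m) powr (1 / p) \<le> (K * X) powr (1 / p)"
    using \<omega>0 p by (intro powr_mono2 infsum_nonneg) auto
  also have "\<dots> = K powr (1 / p) * X powr (1 / p)"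
    using K0 X0 by (simp add: powr_mult)
  finally show "lp_norm p \<omega> (\<lambda>m. enn2real (maximal_op \<omega> x m)) \<le> K powr (1 / p) * lp_norm p \<omega> x"
    by (simp add: lp_norm_def g_def X_def)
qed

theorem theorem4p2:
  "(\<exists>C :: ennreal \<Rightarrow> real.
      (\<forall>K. 0 < C K) \<and>
      (\<forall>\<omega>\<in>A1_weights. \<forall>x\<in>lp_space 1 \<omega>. \<forall>t>0.
         weight_of \<omega> {k. maximal_op \<omega> x k > ennreal t}
           \<le> ennreal (C (A1_norm \<omega>) / t * lp_norm 1 \<omega> x)))
   \<and>
   (\<exists>C :: real \<Rightarrow> ennreal \<Rightarrow> real.
      (\<forall>p K. 0 < C p K) \<and>
      (\<forall>p>1. \<forall>\<omega>\<in>Ap_weights p. \<forall>x\<in>lp_space p \<omega>.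
         (\<forall>m. maximal_op \<omega> x m < \<infinity>) \<and>
         (\<lambda>m. enn2real (maximal_op \<omega> x m)) \<in> lp_space p \<omega> \<and>
         lp_norm p \<omega> (\<lambda>m. enn2real (maximal_op \<omega> x m))
           \<le> C p (Ap_norm p \<omega>) * lp_norm p \<omega> x))"
proof (intro conjI)
  show "\<exists>C :: ennreal \<Rightarrow> real. (\<forall>K. 0 < C K) \<and>
      (\<forall>\<omega>\<in>A1_weights. \<forall>x\<in>lp_space 1 \<omega>. \<forall>t>0.
         weight_of \<omega> {k. maximal_op \<omega> x k > ennreal t}
           \<le> ennreal (C (A1_norm \<omega>) / t * lp_norm 1 \<omega> x))"
    \<comment> \<open>The witness 2 is the overlap bound of the subcover.\<close>
    using weight_maximal_op_superlevel_le
    by (intro exI[of _ "\<lambda>_. 2"]) (auto simp: A1_weights_def)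
next
  \<comment> \<open>The value 1 is a filler for \<open>p \<le> 1\<close>, where \<open>C\<close>
    must be positive as well.\<close>
  define C :: "real \<Rightarrow> ennreal \<Rightarrow> real"
    where "C p K = (if 1 < p then (2 powr p * (2 powr (p + 1) * p / (p - 1))) powr (1 / p) else 1)"
    for p K
  have "\<forall>p K. 0 < C p K" by (auto simp: C_def)
  moreover have "\<forall>p>1. \<forall>\<omega>\<in>Ap_weights p. \<forall>x\<in>lp_space p \<omega>.
         (\<forall>m. maximal_op \<omega> x m < \<infinity>) \<and>
         (\<lambda>m. enn2real (maximal_op \<omega> x m)) \<in> lp_space p \<omega> \<and>
         lp_norm p \<omega> (\<lambda>m. enn2real (maximal_op \<omega> x m))
           \<le> C p (Ap_norm p \<omega>) * lp_norm p \<omega> x"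
  proof (intro allI impI ballI)
    fix p :: real and \<omega> x
    assume p: "1 < p" and "\<omega> \<in> Ap_weights p" and x: "x \<in> lp_space p \<omega>"
    then have \<omega>: "discrete_weight \<omega>" by (simp add: Ap_weights_def)
    show "(\<forall>m. maximal_op \<omega> x m < \<infinity>) \<and>
         (\<lambda>m. enn2real (maximal_op \<omega> x m)) \<in> lp_space p \<omega> \<and>
         lp_norm p \<omega> (\<lambda>m. enn2real (maximal_op \<omega> x m))
           \<le> C p (Ap_norm p \<omega>) * lp_norm p \<omega> x"
      using maximal_op_finite[OF \<omega> p x] maximal_op_strong_type[OF \<omega> p x] p
      by (simp add: C_def)
  qed
  ultimately show "\<exists>C :: real \<Rightarrow> ennreal \<Rightarrow> real.
      (\<forall>p K. 0 < C p K) \<and>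
      (\<forall>p>1. \<forall>\<omega>\<in>Ap_weights p. \<forall>x\<in>lp_space p \<omega>.
         (\<forall>m. maximal_op \<omega> x m < \<infinity>) \<and>
         (\<lambda>m. enn2real (maximal_op \<omega> x m)) \<in> lp_space p \<omega> \<and>
         lp_norm p \<omega> (\<lambda>m. enn2real (maximal_op \<omega> x m))
           \<le> C p (Ap_norm p \<omega>) * lp_norm p \<omega> x)"
    by blast
qed

end
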